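(* For a graph $G$ of order $n$, $\operatorname{th}_-(G)=n-1$ if and only if $G$ is a cograph with no induced $2K_2$ and at least one edge.
   Context: Graphs are finite, simple and undirected, with nonempty vertex set. The order of a graph is its number of vertices. A cograph is a graph that can be generated from $K_1$ using only complementation and disjoint union; equivalently, a graph with no induced subgraph isomorphic to the path $P_4$ on four vertices. $2K_2$ is the disjoint union of two copies of $K_2$. Skew zero forcing: each vertex of $G$ is blue or white; initially exactly the vertices of a set $S\subseteq V(G)$ are blue. In each round, simultaneously, every vertex (blue or white) that has exactly one white neighbor at the start of the round colors that neighbor blue. If all vertices eventually become blue, $S$ is a skew zero forcing set, and the skew propagation time $\operatorname{pt}_-(G;S)$ is the number of rounds needed until all vertices are blue ($0$ if $S=V(G)$); otherwise $\operatorname{pt}_-(G;S)=\infty$. Define $\operatorname{th}_-(G;S)=|S|+\operatorname{pt}_-(G;S)$ and the skew throttling number $\operatorname{th}_-(G)=\min_{S\subseteq V(G)}\operatorname{th}_-(G;S)$. *)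

theory Defs
  imports
    "Graph_Theory.Pair_Digraph"
    "Graph_Theory.Digraph_Isomorphism"
    "HOL-Library.Extended_Nat"
begin

text \<open>
  A finite simple undirected graph is a \<^typ>\<open>'a pair_pre_digraph\<close> satisfying
  \<^locale>\<open>pair_graph\<close>: its arc set is a finite, symmetric, irreflexive relation on the
  vertices, each undirected edge being the two opposite arcs. This locale allows the
  empty vertex set.
\<close>

definition graph_complement :: "'a pair_pre_digraph \<Rightarrow> 'a pair_pre_digraph" where
  "graph_complement G = \<lparr>pverts = pverts G,
     parcs = {(u, v). u \<in> pverts G \<and> v \<in> pverts G \<and> u \<noteq> v \<and> (u, v) \<notin> parcs G}\<rparr>"

text \<open>
  Disjoint unions are taken internally, of graphs with disjoint vertex sets inside one
  vertex type. As the \<open>K1\<close> rule admits every vertex, the class is closed under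
  renaming of vertices without a separate rule.
\<close>

inductive cograph :: "'a pair_pre_digraph \<Rightarrow> bool" where
  K1: "cograph \<lparr>pverts = {v}, parcs = {}\<rparr>"
| complement: "cograph G \<Longrightarrow> cograph (graph_complement G)"
| disjoint_union: "cograph G \<Longrightarrow> cograph H \<Longrightarrow> pverts G \<inter> pverts H = {} \<Longrightarrow>
    cograph \<lparr>pverts = pverts G \<union> pverts H, parcs = parcs G \<union> parcs H\<rparr>"

definition two_K2 :: "nat pair_pre_digraph" where
  "two_K2 = \<lparr>pverts = {0, 1, 2, 3}, parcs = {(0, 1), (1, 0), (2, 3), (3, 2)}\<rparr>"

definition has_induced_subgraph_iso :: "'a pair_pre_digraph \<Rightarrow> 'b pair_pre_digraph \<Rightarrow> bool" where
  "has_induced_subgraph_iso G P \<longleftrightarrow>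
     (\<exists>H :: 'a pair_pre_digraph.
        induced_subgraph (with_proj H) (with_proj G) \<and> digraph_iso (with_proj H) (with_proj P))"

definition white_neighbors :: "'a pair_pre_digraph \<Rightarrow> 'a set \<Rightarrow> 'a \<Rightarrow> 'a set" where
  "white_neighbors G B v = {w \<in> pverts G. w \<notin> B \<and> (v, w) \<in> parcs G}"

text \<open>One round of skew forcing; the forcing vertex \<open>v\<close> may itself be white.\<close>

definition skew_round :: "'a pair_pre_digraph \<Rightarrow> 'a set \<Rightarrow> 'a set" where
  "skew_round G B = B \<union> {w. \<exists>v \<in> pverts G. white_neighbors G B v = {w}}"

definition blue_after :: "'a pair_pre_digraph \<Rightarrow> 'a set \<Rightarrow> nat \<Rightarrow> 'a set" where
  "blue_after G S k = (skew_round G ^^ k) S"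

definition skew_zero_forcing_set :: "'a pair_pre_digraph \<Rightarrow> 'a set \<Rightarrow> bool" where
  "skew_zero_forcing_set G S \<longleftrightarrow> S \<subseteq> pverts G \<and> (\<exists>k. blue_after G S k = pverts G)"

definition skew_pt :: "'a pair_pre_digraph \<Rightarrow> 'a set \<Rightarrow> enat" where
  "skew_pt G S =
     (if skew_zero_forcing_set G S then enat (LEAST k. blue_after G S k = pverts G) else \<infinity>)"

definition skew_th_set :: "'a pair_pre_digraph \<Rightarrow> 'a set \<Rightarrow> enat" where
  "skew_th_set G S = enat (card S) + skew_pt G S"

definition skew_th :: "'a pair_pre_digraph \<Rightarrow> enat" where
  "skew_th G = (MIN S \<in> Pow (pverts G). skew_th_set G S)"

end

theory Submission
  imports Defs
begin

text \<open>
  An edge \<open>uv\<close> gives throttling number at most \<open>n - 1\<close>: leave only \<open>u\<close> and \<open>v\<close> white, and they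
  force each other. An induced \<open>P4\<close> or \<open>2K2\<close> left white is forced within two rounds, which gives
  at most \<open>n - 2\<close>.

  Conversely, let \<open>G\<close> have no induced \<open>P4\<close> and no induced \<open>2K2\<close>. Two vertices forced in the same
  round are then adjacent, and no other white vertex is adjacent to both of them. Hence a round
  forces at most two vertices, and a vertex pair forced in a later round would be adjacent to both
  members of an earlier pair, so at most one round forces two. Therefore \<open>t\<close> rounds colour at most
  \<open>t + 1\<close> vertices.

  The complement of such a graph has no induced \<open>P4\<close> or \<open>C4\<close>. There the closed neighbourhood of a
  vertex of maximum degree is a union of components, which yields the cograph decomposition.
\<close>

section \<open>Induced paths and matchings\<close>

text \<open>
  In a simple graph the adjacencies below force the four vertices to be distinct.
\<close>

definition induced_P4 :: "'a rel \<Rightarrow> 'a \<Rightarrow> 'a \<Rightarrow> 'a \<Rightarrow> 'a \<Rightarrow> bool" where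
  "induced_P4 E a b c d \<longleftrightarrow> (a, b) \<in> E \<and> (b, c) \<in> E \<and> (c, d) \<in> E \<and>
     (a, c) \<notin> E \<and> (a, d) \<notin> E \<and> (b, d) \<notin> E"

definition induced_2K2 :: "'a rel \<Rightarrow> 'a \<Rightarrow> 'a \<Rightarrow> 'a \<Rightarrow> 'a \<Rightarrow> bool" where
  "induced_2K2 E a b c d \<longleftrightarrow> (a, b) \<in> E \<and> (c, d) \<in> E \<and>
     (a, c) \<notin> E \<and> (a, d) \<notin> E \<and> (b, c) \<notin> E \<and> (b, d) \<notin> E"

lemma
  assumes "pair_graph G"
  shows pair_graph_finite: "finite (pverts G)"
    and pair_graph_sym: "sym (parcs G)"
    and pair_graph_irrefl: "irrefl (parcs G)"
    and pair_graph_arcs: "parcs G \<subseteq> pverts G \<times> pverts G"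
proof -
  interpret pair_graph G by fact
  show "finite (pverts G)" by (rule pair_finite_verts)
  show "sym (parcs G)" using arcs_symmetric by (auto intro: symI)
  show "irrefl (parcs G)" using pair_no_loops by (fastforce simp: irrefl_def)
  show "parcs G \<subseteq> pverts G \<times> pverts G" by (auto dest: wellformed')
qed

text \<open>Replaces the isomorphism by a pattern of adjacencies among four vertices, the form in
  which all later arguments use it.\<close>

lemma has_induced_two_K2_iff:
  assumes G: "pair_graph G"
  shows "has_induced_subgraph_iso G two_K2 \<longleftrightarrow> (\<exists>a b c d. induced_2K2 (parcs G) a b c d)"
proof
  assume "has_induced_subgraph_iso G two_K2"
  then obtain H :: "'a pair_pre_digraph" and f
    where H: "induced_subgraph (with_proj H) (with_proj G)"
      and f: "pre_digraph.digraph_isomorphism (with_proj H) f"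
      and eq: "with_proj two_K2 = app_iso f (with_proj H)"
    unfolding has_induced_subgraph_iso_def digraph_iso_def by blast
  define h where "h = iso_verts f"
  \<comment> \<open>An isomorphism maps arcs onto arcs; injectivity of \<open>h\<close> on vertices
    recovers the original arc from its image, so adjacency is also reflected.\<close>
  have arcs: "(h u, h v) \<in> parcs two_K2 \<longleftrightarrow> (u, v) \<in> parcs H"
    if "u \<in> pverts H" "v \<in> pverts H" for u v
  proof -
    have img: "parcs two_K2 = (\<lambda>(u, v). (h u, h v)) ` parcs H"
      using arg_cong[OF eq, of arcs_ends] wf_digraph.arcs_ends_app_iso_eq[OF _ f] H
      by (simp add: h_def induced_subgraph_def subgraph_def)
    have inj: "inj_on h (pverts H)"
      using pre_digraph.digraph_isomorphism_inj_on_verts[OF f] by (simp add: h_def)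
    have sub: "parcs H \<subseteq> pverts H \<times> pverts H"
      using H by (auto simp: induced_subgraph_def)
    show ?thesis
    proof
      assume "(h u, h v) \<in> parcs two_K2"
      then obtain u' v' where "(u', v') \<in> parcs H" "h u = h u'" "h v = h v'"
        unfolding img by auto
      with sub show "(u, v) \<in> parcs H"
        using inj_on_eq_iff[OF inj that(1), of u'] inj_on_eq_iff[OF inj that(2), of v'] by auto
    qed (auto simp: img)
  qed
  have "pverts two_K2 = h ` pverts H"
    using arg_cong[OF eq, of verts] by (simp add: h_def)
  then have "{0, 1, 2, 3} = h ` pverts H"
    by (simp add: two_K2_def)
  then have "0 \<in> h ` pverts H" "1 \<in> h ` pverts H" "2 \<in> h ` pverts H" "3 \<in> h ` pverts H"
    by auto
  then obtain a b c d where abcd: "a \<in> pverts H" "b \<in> pverts H" "c \<in> pverts H" "d \<in> pverts H"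
    and h: "h a = 0" "h b = 1" "h c = 2" "h d = 3"
    by (elim imageE) metis
  have "parcs H = {e \<in> parcs G. fst e \<in> pverts H \<and> snd e \<in> pverts H}"
    using H by (simp add: induced_subgraph_def)
  then have "(u, v) \<in> parcs G \<longleftrightarrow> (h u, h v) \<in> parcs two_K2"
    if "u \<in> pverts H" "v \<in> pverts H" for u v
    using arcs[OF that] that by simp
  with abcd h have "induced_2K2 (parcs G) a b c d"
    by (simp add: induced_2K2_def two_K2_def)
  then show "\<exists>a b c d. induced_2K2 (parcs G) a b c d" by blast
next
  assume "\<exists>a b c d. induced_2K2 (parcs G) a b c d"
  then obtain a b c d where abcd: "induced_2K2 (parcs G) a b c d" by blast
  note E = pair_graph_sym[OF G] pair_graph_irrefl[OF G] pair_graph_arcs[OF G]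
  have ne: "a \<noteq> b" "a \<noteq> c" "a \<noteq> d" "b \<noteq> c" "b \<noteq> d" "c \<noteq> d"
    using abcd E(1,2) unfolding induced_2K2_def by (auto dest: symD simp: irrefl_def)
  define H :: "'a pair_pre_digraph" where
    "H = \<lparr>pverts = {a, b, c, d}, parcs = {(a, b), (b, a), (c, d), (d, c)}\<rparr>"
  have wfH: "wf_digraph (with_proj H)"
    by unfold_locales (auto simp: H_def)
  have wfG: "wf_digraph (with_proj G)"
    by unfold_locales (use E(3) in auto)
  have "parcs H = {e \<in> parcs G. fst e \<in> pverts H \<and> snd e \<in> pverts H}"
    using abcd E(1,2) by (auto simp: H_def induced_2K2_def irrefl_def dest: symD)
  then have ind: "induced_subgraph (with_proj H) (with_proj G)"
    using wfG wfH abcd E(1,3)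
    by (auto simp: induced_subgraph_def subgraph_def H_def induced_2K2_def dest: symD)
  \<comment> \<open>The default value 3 is the image of \<open>d\<close>, since only
    \<open>a\<close>, \<open>b\<close>, \<open>c\<close>, \<open>d\<close> are vertices of
    \<open>H\<close>.\<close>
  define h :: "'a \<Rightarrow> nat" where
    "h = (\<lambda>x. if x = a then 0 else if x = b then 1 else if x = c then 2 else 3)"
  define f where "f = \<lparr>iso_verts = h, iso_arcs = map_prod h h, iso_head = snd, iso_tail = fst\<rparr>"
  have "pre_digraph.digraph_isomorphism (with_proj H) f"
    using wfH ne unfolding pre_digraph.digraph_isomorphism_def
    by (auto simp: f_def H_def h_def inj_on_def)
  moreover have "with_proj two_K2 = app_iso f (with_proj H)"
    using ne by (auto simp: with_proj_def two_K2_def app_iso_def f_def H_def h_def)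
  ultimately show "has_induced_subgraph_iso G two_K2"
    using ind unfolding has_induced_subgraph_iso_def digraph_iso_def by blast
qed

section \<open>Cographs\<close>

lemma cograph_simple:
  assumes "cograph G"
  shows "sym (parcs G) \<and> parcs G \<subseteq> pverts G \<times> pverts G"
  using assms by induction (auto simp: graph_complement_def sym_def)

text \<open>Neither operation creates an induced path: \<open>P4\<close> is its own complement, and
  being connected it lies within one part of a disjoint union.\<close>

lemma cograph_not_induced_P4:
  assumes "cograph G"
  shows "\<not> induced_P4 (parcs G) a b c d"
  using assms
proof (induction arbitrary: a b c d)
  case (K1 v)
  then show ?case by (simp add: induced_P4_def)
next
  case (complement G)
  have s: "sym (parcs G)" using cograph_simple[OF complement.hyps] by blast
  show ?case
  proof
    \<comment> \<open>\<open>P4\<close> is self-complementary.\<close>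
    assume "induced_P4 (parcs (graph_complement G)) a b c d"
    then have "induced_P4 (parcs G) b d a c"
      using s by (auto simp: induced_P4_def graph_complement_def dest: symD)
    with complement.IH show False by blast
  qed
next
  case (disjoint_union G H)
  have "parcs G \<subseteq> pverts G \<times> pverts G" "parcs H \<subseteq> pverts H \<times> pverts H"
    using disjoint_union.hyps cograph_simple by blast+
  with disjoint_union.IH disjoint_union.hyps(3) show ?case
    unfolding induced_P4_def by simp blast
qed

text \<open>The hypothesis \<open>free\<close> excludes both \<open>P4\<close> and \<open>C4\<close>.\<close>

lemma cograph_if_no_P4_C4:
  assumes "sym E" and "irrefl E"
    and free: "\<And>a b c d. (a, b) \<in> E \<Longrightarrow> (b, c) \<in> E \<Longrightarrow> (c, d) \<in> E \<Longrightarrow>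
      (a, c) \<notin> E \<Longrightarrow> (b, d) \<notin> E \<Longrightarrow> a \<noteq> c \<Longrightarrow> b \<noteq> d \<Longrightarrow> False"
    and "finite V" and "V \<noteq> {}"
  shows "cograph \<lparr>pverts = V, parcs = E \<inter> V \<times> V\<rparr>"
  using assms(4,5)
proof (induction V rule: finite_psubset_induct)
  case (psubset V)
  let ?G = "\<lambda>U. \<lparr>pverts = U, parcs = E \<inter> U \<times> U\<rparr>"
  define N where "N u = {w \<in> V. (u, w) \<in> E}" for u
  have finN: "finite (N u)" for u using psubset.hyps by (simp add: N_def)
  obtain v where v: "v \<in> V" and max: "\<And>u. u \<in> V \<Longrightarrow> card (N u) \<le> card (N v)"
  proof -
    have "Max ((\<lambda>u. card (N u)) ` V) \<in> (\<lambda>u. card (N u)) ` V"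
      using psubset.hyps psubset.prems by (intro Max_in) auto
    then obtain v where "v \<in> V" "card (N v) = Max ((\<lambda>u. card (N u)) ` V)" by auto
    then show thesis using that psubset.hyps by simp
  qed
  let ?C = "insert v (N v)"
  have CV: "?C \<subseteq> V" using v by (auto simp: N_def)
  show ?case
  proof (cases "?C = V")
    case False
    \<comment> \<open>Suppose a neighbour \<open>w\<close> of \<open>v\<close> has a neighbour
      \<open>u\<close> outside \<open>?C\<close>. Maximality of the degree of \<open>v\<close>
      yields a neighbour \<open>x\<close> of \<open>v\<close> not adjacent to \<open>w\<close>, and
      \<open>x\<close>, \<open>v\<close>, \<open>w\<close>, \<open>u\<close> is the pattern excluded
      by \<open>free\<close>.\<close>
    have closed: "u \<in> ?C" if wu: "w \<in> ?C" "u \<in> V" "(w, u) \<in> E" for w u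
    proof (rule ccontr)
      assume u: "u \<notin> ?C"
      then have "w \<noteq> v" using wu by (auto simp: N_def)
      then have w: "w \<in> V" "(v, w) \<in> E" using wu(1) by (auto simp: N_def)
      have "u \<in> N w" "v \<in> N w" "v \<notin> N v" "u \<notin> N v" "u \<noteq> v"
        using wu v w u assms(1,2) by (auto simp: N_def irrefl_def dest: symD)
      \<comment> \<open>Otherwise \<open>N w\<close> would contain \<open>u\<close> and
        \<open>v\<close> in exchange for the one vertex \<open>w\<close> of \<open>N v\<close>, so
        \<open>w\<close> would have larger degree than \<open>v\<close>.\<close>
      have "\<not> N v - {w} \<subseteq> N w"
      proof
        assume "N v - {w} \<subseteq> N w"
        then have "insert u (insert v (N v - {w})) \<subseteq> N w"
          using \<open>u \<in> N w\<close> \<open>v \<in> N w\<close> by blast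
        then have "card (insert u (insert v (N v - {w}))) \<le> card (N w)"
          by (rule card_mono[OF finN])
        moreover have "card (insert u (insert v (N v - {w}))) = card (N v - {w}) + 2"
          using finN[of v] \<open>v \<notin> N v\<close> \<open>u \<notin> N v\<close> \<open>u \<noteq> v\<close> by simp
        moreover have "card (N v) = Suc (card (N v - {w}))"
          using w by (intro card.remove[OF finN]) (simp add: N_def)
        ultimately show False
          using max[OF w(1)] by linarith
      qed
      then obtain x where x: "x \<in> V" "(v, x) \<in> E" "(w, x) \<notin> E" "x \<noteq> w"
        by (auto simp: N_def)
      show False
        using free[of x v w u] x w wu u assms(1) by (auto simp: N_def dest: symD)
    qed
    have "cograph (?G ?C)" "cograph (?G (V - ?C))"
      using psubset.IH[of ?C] psubset.IH[of "V - ?C"] CV False v by auto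
    from cograph.disjoint_union[OF this]
    have "cograph \<lparr>pverts = ?C \<union> (V - ?C),
        parcs = E \<inter> ?C \<times> ?C \<union> E \<inter> (V - ?C) \<times> (V - ?C)\<rparr>"
      by (simp only: pair_pre_digraph.simps Diff_disjoint simp_thms)
    moreover have "?C \<union> (V - ?C) = V" using CV by blast
    moreover have "E \<inter> ?C \<times> ?C \<union> E \<inter> (V - ?C) \<times> (V - ?C) = E \<inter> V \<times> V"
      using CV closed assms(1) by (blast dest: symD)
    ultimately show ?thesis by simp
  next
    case True
    then have univ: "(v, u) \<in> E" "(u, v) \<in> E" if "u \<in> V" "u \<noteq> v" for u
      using that assms(1) by (auto simp: N_def dest: symD)
    show ?thesis
    proof (cases "V = {v}")
      case True
      then have "?G V = \<lparr>pverts = {v}, parcs = {}\<rparr>"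
        using assms(2) by (auto simp: irrefl_def)
      then show ?thesis by (simp only: cograph.K1)
    next
      case False
      with v have "cograph (?G (V - {v}))" by (intro psubset.IH) auto
      \<comment> \<open>A universal vertex \<open>v\<close> is added by complementing the rest,
        joining \<open>v\<close> as an isolated vertex and complementing back.\<close>
      from cograph.complement[OF cograph.disjoint_union[OF cograph.K1[of v]
            cograph.complement[OF this]]]
      have "cograph (graph_complement \<lparr>pverts = {v} \<union> (V - {v}),
          parcs = {} \<union> parcs (graph_complement (?G (V - {v})))\<rparr>)"
        by (simp add: graph_complement_def)
      also have "graph_complement \<lparr>pverts = {v} \<union> (V - {v}),
          parcs = {} \<union> parcs (graph_complement (?G (V - {v})))\<rparr> = ?G V"
        using univ v assms(2) by (auto simp: graph_complement_def irrefl_def)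
      finally show ?thesis .
    qed
  qed
qed

lemma cograph_if_no_P4_2K2:
  assumes G: "pair_graph G" and "pverts G \<noteq> {}"
    and P4: "\<And>a b c d. \<not> induced_P4 (parcs G) a b c d"
    and K2: "\<And>a b c d. \<not> induced_2K2 (parcs G) a b c d"
  shows "cograph G"
proof -
  note E = pair_graph_sym[OF G] pair_graph_irrefl[OF G] pair_graph_arcs[OF G]
  let ?E = "parcs (graph_complement G)"
  have "cograph \<lparr>pverts = pverts G, parcs = ?E \<inter> pverts G \<times> pverts G\<rparr>"
  proof (rule cograph_if_no_P4_C4)
    show "sym ?E" using E(1) by (auto simp: graph_complement_def sym_def)
    show "irrefl ?E" by (auto simp: graph_complement_def irrefl_def)
    fix a b c d
    assume *: "(a, b) \<in> ?E" "(b, c) \<in> ?E" "(c, d) \<in> ?E" "(a, c) \<notin> ?E" "(b, d) \<notin> ?E"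
      "a \<noteq> c" "b \<noteq> d"
    \<comment> \<open>In \<open>G\<close>, \<open>ac\<close> and \<open>bd\<close> are edges while
      \<open>ab\<close>, \<open>bc\<close>, \<open>cd\<close> are not. The cases are whether
      \<open>a\<close> and \<open>d\<close> are adjacent in \<open>G\<close>: if not, the two edges
      form a \<open>2K2\<close>; if so, \<open>c\<close>, \<open>a\<close>, \<open>d\<close>,
      \<open>b\<close> is an induced path.\<close>
    then have "induced_2K2 (parcs G) a c b d \<or> induced_P4 (parcs G) c a d b"
      using E(1) unfolding induced_2K2_def induced_P4_def graph_complement_def
      by (auto dest: symD)
    with P4 K2 show False by blast
  qed (use assms(2) pair_graph_finite[OF G] in auto)
  from cograph.complement[OF this] show ?thesis
    using E(2,3)
    by (elim back_subst[where P = cograph])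
      (auto simp: graph_complement_def irrefl_def intro!: pair_pre_digraph.equality)
qed

section \<open>Skew forcing\<close>

lemma subset_skew_round: "B \<subseteq> skew_round G B"
  by (auto simp: skew_round_def)

lemma skew_round_subset: "B \<subseteq> pverts G \<Longrightarrow> skew_round G B \<subseteq> pverts G"
  by (auto simp: skew_round_def white_neighbors_def)

lemma blue_after_0 [simp]: "blue_after G S 0 = S"
  by (simp add: blue_after_def)

lemma blue_after_Suc: "blue_after G S (Suc k) = skew_round G (blue_after G S k)"
  by (simp add: blue_after_def)

text \<open>Splits off the first round instead of the last, for the induction that waits for the
  first round forcing two vertices.\<close>

lemma blue_after_Suc_shift: "blue_after G S (Suc k) = blue_after G (skew_round G S) k"
  by (simp add: blue_after_def funpow_swap1)

lemma subset_blue_after: "S \<subseteq> blue_after G S k"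
  by (induction k) (use subset_skew_round in \<open>force simp: blue_after_Suc\<close>)+

lemma blue_after_subset: "S \<subseteq> pverts G \<Longrightarrow> blue_after G S k \<subseteq> pverts G"
  by (induction k) (auto simp: blue_after_Suc dest: skew_round_subset)

text \<open>Covers blue targets \<open>w\<close> as well, so that applications need not track the
  colour of \<open>w\<close>.\<close>

lemma skew_roundI:
  assumes "v \<in> pverts G" "w \<in> pverts G" "(v, w) \<in> parcs G"
    and "\<And>u. (v, u) \<in> parcs G \<Longrightarrow> u \<in> pverts G \<Longrightarrow> u \<noteq> w \<Longrightarrow> u \<in> B"
  shows "w \<in> skew_round G B"
proof (cases "w \<in> B")
  case False
  then have "white_neighbors G B v = {w}"
    using assms by (auto simp: white_neighbors_def)
  with assms(1) show ?thesis by (auto simp: skew_round_def)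
qed (simp add: skew_round_def)

lemma skew_th_le:
  assumes "finite (pverts G)" "S \<subseteq> pverts G" "blue_after G S k = pverts G"
  shows "skew_th G \<le> enat (card S + k)"
proof -
  have "skew_th G \<le> skew_th_set G S"
    unfolding skew_th_def using assms by (intro Min_le) auto
  also have "\<dots> \<le> enat (card S + k)"
    using assms Least_le[of "\<lambda>k. blue_after G S k = pverts G" k]
    by (auto simp: skew_th_set_def skew_pt_def skew_zero_forcing_set_def)
  finally show ?thesis .
qed

lemma skew_th_attained:
  assumes "finite (pverts G)"
  obtains S k where "S \<subseteq> pverts G" "blue_after G S k = pverts G" "skew_th G = enat (card S + k)"
proof -
  have "skew_th G \<in> skew_th_set G ` Pow (pverts G)"
    unfolding skew_th_def using assms by (intro Min_in) auto
  then obtain S where S: "S \<subseteq> pverts G" "skew_th G = skew_th_set G S" by auto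
  \<comment> \<open>The whole vertex set is blue after 0 rounds, so the minimum is finite and a
    minimizing \<open>S\<close> must be a skew zero forcing set.\<close>
  have "skew_th G \<le> enat (card (pverts G) + 0)"
    by (rule skew_th_le[where S = "pverts G"]) (use assms in auto)
  then have "skew_zero_forcing_set G S"
    using S by (auto simp: skew_th_set_def skew_pt_def split: if_splits)
  moreover from this have "blue_after G S (LEAST k. blue_after G S k = pverts G) = pverts G"
    using LeastI_ex[of "\<lambda>k. blue_after G S k = pverts G"]
    by (simp add: skew_zero_forcing_set_def)
  ultimately show ?thesis
    using S that by (simp add: skew_th_set_def skew_pt_def)
qed

section \<open>Upper bounds from an edge, an induced path and an induced matching\<close>

lemma skew_th_le_if_edge:
  assumes G: "pair_graph G" and ab: "(a, b) \<in> parcs G"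
  shows "skew_th G \<le> enat (card (pverts G) - 1)"
proof -
  note E = pair_graph_sym[OF G] pair_graph_irrefl[OF G] pair_graph_arcs[OF G]
  let ?S = "pverts G - {a, b}"
  have ba: "(b, a) \<in> parcs G" "a \<in> pverts G" "b \<in> pverts G" "a \<noteq> b"
    using ab E by (auto simp: irrefl_def dest: symD)
  have "a \<in> skew_round G ?S"
    by (rule skew_roundI[of b]) (use ba E(2) in \<open>auto simp: irrefl_def\<close>)
  moreover have "b \<in> skew_round G ?S"
    by (rule skew_roundI[of a]) (use ab ba E(2) in \<open>auto simp: irrefl_def\<close>)
  ultimately have "blue_after G ?S 1 = pverts G"
    using subset_skew_round[of ?S G] skew_round_subset[of ?S G] by (auto simp: blue_after_def)
  then have "skew_th G \<le> enat (card ?S + 1)"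
    by (intro skew_th_le pair_graph_finite[OF G]) auto
  moreover have "card {a, b} \<le> card (pverts G)"
    using ba pair_graph_finite[OF G] by (intro card_mono) auto
  moreover have "card ?S = card (pverts G) - card {a, b}"
    using ba by (intro card_Diff_subset) auto
  moreover have "card {a, b} = 2"
    using ba by simp
  ultimately show ?thesis
    by (simp del: card_insert_disjoint) (metis Suc_diff_Suc diff_Suc_1 Suc_le_eq numeral_2_eq_2)
qed

lemma skew_th_less_if_four:
  assumes G: "pair_graph G"
    and abcd: "{a, b, c, d} \<subseteq> pverts G" "card {a, b, c, d} = 4"
    and blue: "blue_after G (pverts G - {a, b, c, d}) 2 = pverts G"
  shows "skew_th G < enat (card (pverts G) - 1)"
proof -
  have "skew_th G \<le> enat (card (pverts G - {a, b, c, d}) + 2)"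
    using blue by (intro skew_th_le pair_graph_finite[OF G]) auto
  also have "card (pverts G - {a, b, c, d}) = card (pverts G) - 4"
    using abcd by (subst card_Diff_subset) auto
  \<comment> \<open>Four distinct vertices give order at least 4, so the truncated subtractions are
    exact and the sum is the order minus 2.\<close>
  also have "enat (card (pverts G) - 4 + 2) < enat (card (pverts G) - 1)"
    using abcd card_mono[OF pair_graph_finite[OF G] abcd(1)] by simp
  finally show ?thesis .
qed

lemma skew_th_less_if_P4:
  assumes G: "pair_graph G" and P: "induced_P4 (parcs G) a b c d"
  shows "skew_th G < enat (card (pverts G) - 1)"
proof (rule skew_th_less_if_four[OF G])
  note E = pair_graph_sym[OF G] pair_graph_irrefl[OF G] pair_graph_arcs[OF G]
  show V: "{a, b, c, d} \<subseteq> pverts G" using P E(3) by (auto simp: induced_P4_def)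
  have ne: "a \<noteq> b" "a \<noteq> c" "a \<noteq> d" "b \<noteq> c" "b \<noteq> d" "c \<noteq> d"
    using P E(1,2) unfolding induced_P4_def by (auto dest: symD simp: irrefl_def)
  then show "card {a, b, c, d} = 4" by simp
  have adj: "(a, b) \<in> parcs G" "(b, a) \<in> parcs G" "(c, d) \<in> parcs G" "(d, c) \<in> parcs G"
    and nadj: "(a, c) \<notin> parcs G" "(a, d) \<notin> parcs G" "(b, d) \<notin> parcs G"
      "(c, a) \<notin> parcs G" "(d, a) \<notin> parcs G" "(d, b) \<notin> parcs G"
      "(a, a) \<notin> parcs G" "(b, b) \<notin> parcs G" "(c, c) \<notin> parcs G" "(d, d) \<notin> parcs G"
    using P E(1,2) by (auto simp: induced_P4_def irrefl_def dest: symD)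
  let ?S = "pverts G - {a, b, c, d}"
  \<comment> \<open>In the first round the ends \<open>a\<close> and \<open>d\<close> each have a
    single white neighbour, \<open>b\<close> and \<open>c\<close>; in the second round
    \<open>b\<close> and \<open>c\<close> force the ends back.\<close>
  have S1: "pverts G - {a, d} \<subseteq> skew_round G ?S"
  proof -
    have "b \<in> skew_round G ?S"
      by (rule skew_roundI[of a]) (use V adj nadj in auto)
    moreover have "c \<in> skew_round G ?S"
      by (rule skew_roundI[of d]) (use V adj nadj in auto)
    ultimately show ?thesis using subset_skew_round[of ?S G] by blast
  qed
  have "a \<in> skew_round G (skew_round G ?S)"
    by (rule skew_roundI[of b]) (use V adj nadj S1 in auto)
  moreover have "d \<in> skew_round G (skew_round G ?S)"
    by (rule skew_roundI[of c]) (use V adj nadj S1 in auto)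
  moreover have "skew_round G ?S \<subseteq> skew_round G (skew_round G ?S)"
    by (rule subset_skew_round)
  moreover have "skew_round G (skew_round G ?S) \<subseteq> pverts G"
    by (intro skew_round_subset) auto
  ultimately show "blue_after G ?S 2 = pverts G"
    using S1 by (auto simp: blue_after_def numeral_2_eq_2)
qed

text \<open>With only these four vertices white, each is forced by its partner in the first round.
  The second round is idle and serves to fit \<open>skew_th_less_if_four\<close>.\<close>

lemma skew_th_less_if_2K2:
  assumes G: "pair_graph G" and P: "induced_2K2 (parcs G) a b c d"
  shows "skew_th G < enat (card (pverts G) - 1)"
proof (rule skew_th_less_if_four[OF G])
  note E = pair_graph_sym[OF G] pair_graph_irrefl[OF G] pair_graph_arcs[OF G]
  show V: "{a, b, c, d} \<subseteq> pverts G" using P E(1,3) by (auto simp: induced_2K2_def)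
  have ne: "a \<noteq> b" "a \<noteq> c" "a \<noteq> d" "b \<noteq> c" "b \<noteq> d" "c \<noteq> d"
    using P E(1,2) unfolding induced_2K2_def by (auto dest: symD simp: irrefl_def)
  then show "card {a, b, c, d} = 4" by simp
  have adj: "(a, b) \<in> parcs G" "(b, a) \<in> parcs G" "(c, d) \<in> parcs G" "(d, c) \<in> parcs G"
    and nadj: "(a, c) \<notin> parcs G" "(a, d) \<notin> parcs G" "(b, c) \<notin> parcs G" "(b, d) \<notin> parcs G"
      "(c, a) \<notin> parcs G" "(d, a) \<notin> parcs G" "(c, b) \<notin> parcs G" "(d, b) \<notin> parcs G"
      "(a, a) \<notin> parcs G" "(b, b) \<notin> parcs G" "(c, c) \<notin> parcs G" "(d, d) \<notin> parcs G"
    using P E(1,2) by (auto simp: induced_2K2_def irrefl_def dest: symD)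
  let ?S = "pverts G - {a, b, c, d}"
  have "a \<in> skew_round G ?S" by (rule skew_roundI[of b]) (use V adj nadj in auto)
  moreover have "b \<in> skew_round G ?S" by (rule skew_roundI[of a]) (use V adj nadj in auto)
  moreover have "c \<in> skew_round G ?S" by (rule skew_roundI[of d]) (use V adj nadj in auto)
  moreover have "d \<in> skew_round G ?S" by (rule skew_roundI[of c]) (use V adj nadj in auto)
  ultimately have "pverts G \<subseteq> skew_round G ?S"
    using subset_skew_round[of ?S G] by blast
  moreover have "skew_round G ?S \<subseteq> skew_round G (skew_round G ?S)"
    by (rule subset_skew_round)
  moreover have "skew_round G (skew_round G ?S) \<subseteq> pverts G"
    by (intro skew_round_subset) auto
  ultimately show "blue_after G ?S 2 = pverts G"
    by (auto simp: blue_after_def numeral_2_eq_2)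
qed

section \<open>Rounds without induced paths and matchings\<close>

locale P4_2K2_free_graph =
  fixes G :: "'a pair_pre_digraph"
  assumes pair_graph: "pair_graph G"
    and no_P4: "\<not> induced_P4 (parcs G) a b c d"
    and no_2K2: "\<not> induced_2K2 (parcs G) a b c d"
begin

lemma adj_sym: "(u, v) \<in> parcs G \<Longrightarrow> (v, u) \<in> parcs G"
  using pair_graph_sym[OF pair_graph] by (rule symD)

lemma adj_vertex: "(u, v) \<in> parcs G \<Longrightarrow> u \<in> pverts G" "(u, v) \<in> parcs G \<Longrightarrow> v \<in> pverts G"
  using pair_graph_arcs[OF pair_graph] by auto

text \<open>If \<open>b\<close> were adjacent to neither \<open>c\<close> nor \<open>d\<close>, the
  two edges would form a \<open>2K2\<close>; if to exactly one of them, an induced path starting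
  \<open>a\<close>, \<open>b\<close> would arise.\<close>

lemma edges_joined_twice:
  assumes "(a, b) \<in> parcs G" "(c, d) \<in> parcs G" "(a, c) \<notin> parcs G" "(a, d) \<notin> parcs G"
  shows "(b, c) \<in> parcs G" "(b, d) \<in> parcs G"
  using assms no_2K2[of a b c d] no_P4[of a b c d] no_P4[of a b d c] adj_sym
  unfolding induced_2K2_def induced_P4_def by blast+

lemma white_neighbors_singletonD:
  assumes "white_neighbors G B v = {w}"
  shows "(v, w) \<in> parcs G" "w \<notin> B" "(v, x) \<in> parcs G \<Longrightarrow> x \<notin> B \<Longrightarrow> x = w"
  using assms adj_vertex unfolding white_neighbors_def by blast+

text \<open>Each forcing vertex has one white neighbour, so it misses the other's target. If
  \<open>v1\<close> and \<open>v2\<close> are adjacent, nonadjacent targets would give the induced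
  path \<open>w1\<close>, \<open>v1\<close>, \<open>v2\<close>, \<open>w2\<close>; otherwise the
  edges \<open>v1 w1\<close> and \<open>v2 w2\<close> fall under
  \<open>edges_joined_twice\<close>.\<close>

lemma forced_adjacent:
  assumes 1: "white_neighbors G B v1 = {w1}" and 2: "white_neighbors G B v2 = {w2}"
    and ne: "w1 \<noteq> w2"
  shows "(w1, w2) \<in> parcs G"
proof -
  note w1 = white_neighbors_singletonD[OF 1] and w2 = white_neighbors_singletonD[OF 2]
  have nadj: "(v1, w2) \<notin> parcs G" "(v2, w1) \<notin> parcs G"
    using w1 w2 ne by blast+
  show ?thesis
  proof (cases "(v1, v2) \<in> parcs G")
    case True
    then show ?thesis
      using no_P4[of w1 v1 v2 w2] w1(1) w2(1) nadj adj_sym unfolding induced_P4_def by blast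
  next
    case False
    then show ?thesis
      using edges_joined_twice(2)[of v1 w1 v2 w2] w1(1) w2(1) nadj by blast
  qed
qed

text \<open>The vertices \<open>v1\<close> and \<open>v2\<close> are adjacent, as otherwise
  \<open>v1\<close>, \<open>w1\<close>, \<open>w2\<close>, \<open>v2\<close> is an induced path.
  Being white, \<open>x\<close> is adjacent to neither of them, so \<open>v1\<close>,
  \<open>v2\<close>, \<open>w2\<close>, \<open>x\<close> is an induced path.\<close>

lemma forced_no_common_white_neighbor:
  assumes 1: "white_neighbors G B v1 = {w1}" and 2: "white_neighbors G B v2 = {w2}"
    and ne: "w1 \<noteq> w2" and x: "x \<notin> B" "x \<noteq> w1" "x \<noteq> w2"
    and adj: "(w1, x) \<in> parcs G" "(w2, x) \<in> parcs G"
  shows False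
proof -
  note w1 = white_neighbors_singletonD[OF 1] and w2 = white_neighbors_singletonD[OF 2]
  have nadj: "(v1, w2) \<notin> parcs G" "(v2, w1) \<notin> parcs G" "(v1, x) \<notin> parcs G" "(v2, x) \<notin> parcs G"
    using w1 w2 ne x by blast+
  have "(v2, v1) \<in> parcs G"
    using no_P4[of v1 w1 w2 v2] w1(1) w2(1) nadj adj_sym forced_adjacent[OF 1 2 ne]
    unfolding induced_P4_def by blast
  then show False
    using no_P4[of v1 v2 w2 x] nadj w2(1) adj adj_sym unfolding induced_P4_def by blast
qed

lemma skew_roundE:
  assumes "w \<in> skew_round G B - B"
  obtains v where "white_neighbors G B v = {w}"
  using assms by (auto simp: skew_round_def)

lemma card_skew_round_le_2:
  "card (skew_round G B - B) \<le> 2"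
proof (rule ccontr)
  assume "\<not> card (skew_round G B - B) \<le> 2"
  then have "3 \<le> card (skew_round G B - B)" by simp
  then obtain T where T: "T \<subseteq> skew_round G B - B" "card T = 3"
    by (meson obtain_subset_with_card_n)
  then obtain x y z where xyz: "T = {x, y, z}" "x \<noteq> y" "x \<noteq> z" "y \<noteq> z"
    by (auto simp: card_3_iff)
  with T have in_round: "x \<in> skew_round G B - B" "y \<in> skew_round G B - B" "z \<in> skew_round G B - B"
    by auto
  then obtain u v w where "white_neighbors G B u = {x}" "white_neighbors G B v = {y}"
    "white_neighbors G B w = {z}"
    by (metis skew_roundE)
  \<comment> \<open>All three forced vertices are pairwise adjacent, so \<open>z\<close> is a common
    white neighbour of \<open>x\<close> and \<open>y\<close>.\<close>
  then show False
    using forced_no_common_white_neighbor[of B u x v y z] forced_adjacent xyz in_round by blast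
qed

text \<open>Taking any \<open>B'\<close> above the result of the first round covers every later
  round, not just the next one.\<close>

lemma card_later_round_le_1:
  assumes two: "card (skew_round G B - B) = 2" and sub: "skew_round G B \<subseteq> B'"
  shows "card (skew_round G B' - B') \<le> 1"
proof (rule ccontr)
  assume "\<not> card (skew_round G B' - B') \<le> 1"
  then have "2 \<le> card (skew_round G B' - B')" by simp
  then obtain T where T: "T \<subseteq> skew_round G B' - B'" "card T = 2"
    by (meson obtain_subset_with_card_n)
  then obtain x y where "T = {x, y}" "x \<noteq> y"
    by (auto simp: card_2_iff)
  with T have xy: "x \<in> skew_round G B' - B'" "y \<in> skew_round G B' - B'" "x \<noteq> y"
    by auto
  then have "(x, y) \<in> parcs G"
    using forced_adjacent by (metis skew_roundE)
  obtain w1 w2 where w: "skew_round G B - B = {w1, w2}" "w1 \<noteq> w2"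
    using two by (auto simp: card_2_iff)
  then obtain v1 v2 where v: "white_neighbors G B v1 = {w1}" "white_neighbors G B v2 = {w2}"
    by (metis insertI1 insertI2 skew_roundE)
  have white: "x \<notin> B" "y \<notin> B" "x \<noteq> w1" "x \<noteq> w2" "y \<noteq> w1" "y \<noteq> w2"
    using xy sub w(1) subset_skew_round[of B G] by blast+
  \<comment> \<open>A vertex \<open>v\<close> forcing \<open>w\<close> in the earlier round misses
    \<open>x\<close> and \<open>y\<close>, both still white then. So the edges \<open>v w\<close>
    and \<open>x y\<close> make \<open>w\<close> adjacent to \<open>x\<close>, and \<open>x\<close>
    becomes a common white neighbour of \<open>w1\<close> and \<open>w2\<close>.\<close>
  have adj: "(w, x) \<in> parcs G"
    if "white_neighbors G B v = {w}" "x \<noteq> w" "y \<noteq> w" for v w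
    using white_neighbors_singletonD[OF that(1)] that(2,3) white(1,2) \<open>(x, y) \<in> parcs G\<close>
    by (intro edges_joined_twice(1)[of v w x y]) blast+
  show False
    using forced_no_common_white_neighbor[OF v w(2) white(1,3,4)] adj v white by blast
qed

section \<open>Counting blue vertices over all rounds\<close>

lemma finite_blue: "B \<subseteq> pverts G \<Longrightarrow> finite B"
  using pair_graph_finite[OF pair_graph] finite_subset by blast

lemma card_skew_round:
  assumes "B \<subseteq> pverts G"
  shows "card (skew_round G B) = card B + card (skew_round G B - B)"
proof -
  have "finite (skew_round G B)" by (rule finite_blue[OF skew_round_subset[OF assms]])
  then show ?thesis
    using card_Diff_subset[OF finite_blue[OF assms] subset_skew_round]
      card_mono[OF _ subset_skew_round, of G B] by simp
qed

lemma card_blue_after_slow: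
  assumes "B \<subseteq> pverts G"
    and "\<And>B'. B \<subseteq> B' \<Longrightarrow> card (skew_round G B' - B') \<le> 1"
  shows "card (blue_after G B k) \<le> card B + k"
proof (induction k)
  case (Suc k)
  then show ?case
    using card_skew_round[OF blue_after_subset[OF assms(1)], of k]
      assms(2)[OF subset_blue_after[of B G k]]
    by (simp add: blue_after_Suc)
qed simp

text \<open>The summand 1 pays for the only round that may force two vertices: up to that round the
  induction proceeds, and from then on \<open>card_blue_after_slow\<close> applies.\<close>

lemma card_blue_after_le:
  assumes "B \<subseteq> pverts G"
  shows "card (blue_after G B k) \<le> card B + k + 1"
  using assms
proof (induction k arbitrary: B)
  case (Suc k)
  let ?R = "skew_round G B"
  have R: "?R \<subseteq> pverts G" using Suc.prems by (rule skew_round_subset)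
  show ?case
  proof (cases "card (?R - B) \<le> 1")
    case True
    then show ?thesis
      using Suc.IH[OF R] card_skew_round[OF Suc.prems] by (simp add: blue_after_Suc_shift)
  next
    case False
    then have two: "card (?R - B) = 2" using card_skew_round_le_2[of B] by simp
    have "card (blue_after G ?R k) \<le> card ?R + k"
      using R card_later_round_le_1[OF two] by (rule card_blue_after_slow)
    then show ?thesis
      using two card_skew_round[OF Suc.prems] by (simp add: blue_after_Suc_shift)
  qed
qed simp

end

theorem theorem2p7:
  fixes G :: "'a pair_pre_digraph" and n :: nat
  assumes "pair_graph G"
    and "pverts G \<noteq> {}"
    and "n = card (pverts G)"
  shows "skew_th G = enat (n - 1) \<longleftrightarrow>
    cograph G \<and> \<not> has_induced_subgraph_iso G two_K2 \<and> parcs G \<noteq> {}"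
proof
  have fin: "finite (pverts G)" by (rule pair_graph_finite[OF assms(1)])
  \<comment> \<open>An optimal blue set \<open>S\<close> with \<open>k\<close> rounds serves both
    directions.\<close>
  obtain S k where S: "S \<subseteq> pverts G" "blue_after G S k = pverts G"
    and th: "skew_th G = enat (card S + k)"
    using skew_th_attained[OF fin] .
  {
    assume eq: "skew_th G = enat (n - 1)"
    have P4: "\<not> induced_P4 (parcs G) a b c d" for a b c d
      using skew_th_less_if_P4[OF assms(1)] eq assms(3) by fastforce
    have K2: "\<not> induced_2K2 (parcs G) a b c d" for a b c d
      using skew_th_less_if_2K2[OF assms(1)] eq assms(3) by fastforce
    have "parcs G \<noteq> {}"
    proof
      assume "parcs G = {}"
      \<comment> \<open>Without edges nothing is ever forced, so \<open>S\<close> is the whole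
        vertex set and the throttling number is at least \<open>n\<close>.\<close>
      then have "skew_round G B = B" for B
        by (simp add: skew_round_def white_neighbors_def)
      then have "blue_after G S k = S"
        by (induction k) (simp_all add: blue_after_Suc)
      then have "card S = n" using S(2) assms(3) by simp
      \<comment> \<open>Positivity makes \<open>n - 1\<close> differ from \<open>n\<close> in
        truncated subtraction.\<close>
      moreover have "n > 0" using assms(2,3) fin by (simp add: card_gt_0_iff)
      ultimately show False using eq th by simp
    qed
    then show "cograph G \<and> \<not> has_induced_subgraph_iso G two_K2 \<and> parcs G \<noteq> {}"
      using cograph_if_no_P4_2K2[OF assms(1,2) P4 K2] K2 has_induced_two_K2_iff[OF assms(1)]
      by blast
  next
    assume R: "cograph G \<and> \<not> has_induced_subgraph_iso G two_K2 \<and> parcs G \<noteq> {}"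
    have "P4_2K2_free_graph G"
    proof (rule P4_2K2_free_graph.intro)
      fix a b c d
      show "pair_graph G" by fact
      show "\<not> induced_P4 (parcs G) a b c d" using R by (simp add: cograph_not_induced_P4)
      show "\<not> induced_2K2 (parcs G) a b c d" using R by (simp add: has_induced_two_K2_iff[OF assms(1)])
    qed
    then interpret P4_2K2_free_graph G .
    have "skew_th G \<le> enat (n - 1)"
      using R skew_th_le_if_edge[OF assms(1)] assms(3) by auto
    \<comment> \<open>Lower bound: after \<open>k\<close> rounds all \<open>n\<close> vertices are
      blue, which bounds the optimal value \<open>card S + k\<close> below by
      \<open>n - 1\<close>.\<close>
    moreover have "n \<le> card S + k + 1"
      using card_blue_after_le[OF S(1), of k] S(2) assms(3) by simp
    ultimately show "skew_th G = enat (n - 1)" using th by simp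
  }
qed

end
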